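(* For every $\tau\in\mathbb{H}^2$, $$\theta'[0,\tfrac13]=\frac13\,\frac{\theta'[1,1]\,\theta^3[1,\frac13]}{\theta^2[0,\frac13]\,\theta[0,1]}\qquad\text{and}\qquad \theta'[0,\tfrac23]=\frac13\,\frac{\theta'[1,1]\,\theta^3[1,\frac13]}{\theta^2[0,\frac23]\,\theta[0,0]}.$$
   Context: $\mathbb{H}^2=\{\tau\in\mathbb{C} : \Im\tau>0\}$ is the upper half plane. For $\epsilon,\epsilon'\in\mathbb{R}$, $\zeta\in\mathbb{C}$, $\tau\in\mathbb{H}^2$, the theta function with characteristics is $$\theta[\epsilon,\epsilon'](\zeta,\tau)=\sum_{n\in\mathbb{Z}}\exp\left(2\pi i\left[\tfrac12\left(n+\tfrac{\epsilon}{2}\right)^2\tau+\left(n+\tfrac{\epsilon}{2}\right)\left(\zeta+\tfrac{\epsilon'}{2}\right)\right]\right).$$ Write $\theta[\epsilon,\epsilon']=\theta[\epsilon,\epsilon'](0,\tau)$ and $\theta'[\epsilon,\epsilon']=\frac{\partial}{\partial\zeta}\theta[\epsilon,\epsilon'](\zeta,\tau)\big|_{\zeta=0}$; $\theta^k[\epsilon,\epsilon']$ means the $k$-th power of $\theta[\epsilon,\epsilon']$. *)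

theory Defs
  imports "HOL-Analysis.Analysis"
begin

definition upper_half_plane :: "complex set" where
  "upper_half_plane = {\<tau>. Im \<tau> > 0}"

(* Meaningful for Im tau > 0, where the family is absolutely summable; otherwise infsum may
   take its default value 0. *)
definition theta_char :: "real \<Rightarrow> real \<Rightarrow> complex \<Rightarrow> complex \<Rightarrow> complex" where
  "theta_char \<epsilon> \<epsilon>' \<zeta> \<tau> =
     (\<Sum>\<^sub>\<infinity>n\<in>(UNIV :: int set).
        exp (2 * of_real pi * \<i> *
          (1 / 2 * (of_int n + of_real \<epsilon> / 2)\<^sup>2 * \<tau>
           + (of_int n + of_real \<epsilon> / 2) * (\<zeta> + of_real \<epsilon>' / 2))))"

definition theta_const :: "real \<Rightarrow> real \<Rightarrow> complex \<Rightarrow> complex" where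
  "theta_const \<epsilon> \<epsilon>' \<tau> = theta_char \<epsilon> \<epsilon>' 0 \<tau>"

definition theta_deriv :: "real \<Rightarrow> real \<Rightarrow> complex \<Rightarrow> complex" where
  "theta_deriv \<epsilon> \<epsilon>' \<tau> = deriv (\<lambda>\<zeta>. theta_char \<epsilon> \<epsilon>' \<zeta> \<tau>) 0"

end

theory Submission
  imports Defs "HOL-Complex_Analysis.Complex_Analysis" "HOL-Real_Asymp.Real_Asymp"
begin

text \<open>
  Write \<open>s(z) = \<theta>[0,0](z)\<close> and \<open>o(z) = \<theta>[1,1](z) = \<theta>[1,0](z + 1/2)\<close> for a fixed \<open>\<tau>\<close>; a
  characteristic \<open>\<epsilon>'\<close> is only a shift of the argument by \<open>\<epsilon>'/2\<close>.  Both formulas are the cases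
  \<open>x = 1/6\<close> and \<open>x = 1/3\<close> of a single identity (lemma \<open>theta_triple_derivative\<close>),
  \<open>s(x)\<^sup>2 (3 s'(x) s(3x) - s'(3x) s(x)) = - o(2x)\<^sup>3 o'(0)\<close>,
  the theta form of the formula for \<open>3 \<zeta>(x) - \<zeta>(3x)\<close> of the Weierstrass zeta function.  At these two points \<open>3x\<close> is a
  multiple of 1/2; since \<open>s\<close> is even and has period 1, its derivative vanishes there, and \<open>o(2x)\<close>
  becomes \<open>-\<theta>[1,0](1/6)\<close>.

  The identity has an elementary source.  Splitting \<open>\<int> \<times> \<int>\<close> by the parity of \<open>m + n\<close> turns
  \<open>s(x+y) s(x-y)\<close> into a scalar product \<open>v(2x) \<bullet> v(2y)\<close> and \<open>o(x+y) o(x-y)\<close> into a determinant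
  \<open>det (v(2x), v(2y))\<close>, with the same vector \<open>v(z) = (\<theta>[0,0](z,2\<tau>), \<theta>[1,0](z,2\<tau>))\<close>
  (lemma \<open>theta_product\<close>).  The identity
  \<open>(a \<bullet> b)(c \<bullet> d) - (a \<bullet> d)(c \<bullet> b) = det(a,c) det(b,d)\<close> in the plane then gives a four-variable
  addition formula (lemma \<open>theta_addition\<close>), whose derivative in one direction is the identity above.

  To divide by \<open>s(x)\<close> and \<open>s(3x)\<close>, it has to be known that \<open>s\<close> has no real zeros
  (lemma \<open>theta_real_nonzero\<close>).  The product formula also yields
  \<open>s(z,\<tau>) s(z+1/2,\<tau>) = s(2z+1/2,2\<tau>) s(1/2,2\<tau>)\<close>, so a real zero at \<open>\<tau>\<close> produces real zeros
  at \<open>2\<tau>, 4\<tau>, 8\<tau>, \<dots>\<close>; but \<open>s(x,\<tau>)\<close> tends to 1 uniformly in real \<open>x\<close> as the imaginary part of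
  \<open>\<tau>\<close> grows.
\<close>

section \<open>Convergence of the theta series\<close>

definition theta_term :: "real \<Rightarrow> complex \<Rightarrow> complex \<Rightarrow> int \<Rightarrow> complex" where
  "theta_term \<epsilon> z \<tau> n = exp (2 * of_real pi * \<i> *
     (1 / 2 * (of_int n + of_real \<epsilon> / 2)\<^sup>2 * \<tau> + (of_int n + of_real \<epsilon> / 2) * z))"

abbreviation theta :: "real \<Rightarrow> complex \<Rightarrow> complex \<Rightarrow> complex" where
  "theta \<epsilon> z \<tau> \<equiv> theta_char \<epsilon> 0 z \<tau>"

lemma theta_eq_infsum: "theta \<epsilon> z \<tau> = (\<Sum>\<^sub>\<infinity>n. theta_term \<epsilon> z \<tau> n)"
  by (simp add: theta_char_def theta_term_def)

lemma theta_char_shift: "theta_char \<epsilon> \<epsilon>' z \<tau> = theta \<epsilon> (z + of_real \<epsilon>' / 2) \<tau>"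
  by (simp add: theta_char_def)

lemma norm_theta_term:
  "norm (theta_term \<epsilon> z \<tau> n) =
     exp (- pi * Im \<tau> * (of_int n + \<epsilon> / 2)\<^sup>2 - 2 * pi * Im z * (of_int n + \<epsilon> / 2))"
proof -
  have "complex_of_int n + of_real \<epsilon> / 2 = of_real (of_int n + \<epsilon> / 2)"
    by simp
  then show ?thesis
    unfolding theta_term_def norm_exp_eq_Re
    by (simp only: of_real_power[symmetric]) (simp add: algebra_simps)
qed

lemma summable_on_int:
  fixes f :: "int \<Rightarrow> real"
  assumes "summable (\<lambda>n. norm (f (int n)))" "summable (\<lambda>n. norm (f (- int n)))"
  shows "f summable_on UNIV"
proof -
  have "f summable_on range int"
    using norm_summable_imp_summable_on[OF assms(1)]
    by (subst summable_on_reindex) (auto simp: o_def)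
  moreover have "f summable_on range (\<lambda>n. - int n)"
    using norm_summable_imp_summable_on[OF assms(2)]
    by (subst summable_on_reindex) (auto simp: o_def inj_def)
  ultimately have "f summable_on (range int \<union> range (\<lambda>n. - int n))"
    by (rule summable_on_union)
  also have "range int \<union> range (\<lambda>n. - int n) = UNIV"
  proof -
    have "n \<in> range int \<union> range (\<lambda>n. - int n)" for n
      by (cases n rule: int_cases2) auto
    then show ?thesis by blast
  qed
  finally show ?thesis .
qed

lemma summable_on_gaussian:
  fixes a b c :: real
  assumes "a > 0"
  shows "(\<lambda>n::int. exp (- a * (of_int n + c)\<^sup>2 + b * (of_int n + c))) summable_on UNIV"
proof (rule summable_on_int)
  show "summable (\<lambda>n. norm (exp (- a * (of_int (int n) + c)\<^sup>2 + b * (of_int (int n) + c))))"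
  proof (rule summable_comparison_test_bigo)
    show "summable (\<lambda>n. norm (1 / real n ^ 2))"
      using inverse_power_summable[of 2, where 'a = real] by (simp add: field_simps)
    show "(\<lambda>n. norm (exp (- a * (of_int (int n) + c)\<^sup>2 + b * (of_int (int n) + c))))
            \<in> O(\<lambda>n. 1 / real n ^ 2)"
      using assms by simp real_asymp
  qed
  show "summable (\<lambda>n. norm (exp (- a * (of_int (- int n) + c)\<^sup>2 + b * (of_int (- int n) + c))))"
  proof (rule summable_comparison_test_bigo)
    show "summable (\<lambda>n. norm (1 / real n ^ 2))"
      using inverse_power_summable[of 2, where 'a = real] by (simp add: field_simps)
    show "(\<lambda>n. norm (exp (- a * (of_int (- int n) + c)\<^sup>2 + b * (of_int (- int n) + c))))
            \<in> O(\<lambda>n. 1 / real n ^ 2)"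
      using assms by simp real_asymp
  qed
qed

lemma theta_term_abs_summable:
  assumes "Im \<tau> > 0"
  shows "(\<lambda>n. norm (theta_term \<epsilon> z \<tau> n)) summable_on UNIV"
  using summable_on_gaussian[of "pi * Im \<tau>" "\<epsilon> / 2" "- 2 * pi * Im z"] assms
  by (simp add: norm_theta_term)

lemma theta_has_sum:
  assumes "Im \<tau> > 0"
  shows "(theta_term \<epsilon> z \<tau> has_sum theta \<epsilon> z \<tau>) UNIV"
  unfolding theta_eq_infsum
  by (rule has_sum_infsum[OF abs_summable_summable[OF theta_term_abs_summable[OF assms]]])

text \<open>
  The theta series converges uniformly on every disc about 0: there the imaginary part of \<open>z\<close> is
  bounded, so the linear part of the exponent is at most \<open>K \<bar>u\<bar>\<close> with \<open>u = n + \<epsilon>/2\<close>, and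
  \<open>exp (K \<bar>u\<bar>) \<le> exp (K u) + exp (- K u)\<close> gives a majorant that is a sum of two Gaussians.
\<close>

lemma theta_holomorphic:
  assumes "Im \<tau> > 0"
  shows "(\<lambda>z. theta \<epsilon> z \<tau>) holomorphic_on UNIV"
proof -
  have "(\<lambda>z. theta \<epsilon> z \<tau>) holomorphic_on ball 0 r" for r
  proof -
    define K where "K = 2 * pi * \<bar>r\<bar>"
    define M where "M = (\<lambda>n::int. exp (- (pi * Im \<tau>) * (of_int n + \<epsilon> / 2)\<^sup>2 + K * (of_int n + \<epsilon> / 2))
        + exp (- (pi * Im \<tau>) * (of_int n + \<epsilon> / 2)\<^sup>2 + (- K) * (of_int n + \<epsilon> / 2)))"
    have "M summable_on UNIV"
      unfolding M_def using assms by (intro summable_on_add summable_on_gaussian) auto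
    moreover have "norm (theta_term \<epsilon> z \<tau> n) \<le> M n" if "z \<in> cball 0 r" for n z
    proof -
      define u where "u = of_int n + \<epsilon> / 2"
      have "\<bar>Im z\<bar> \<le> \<bar>r\<bar>"
        using that abs_Im_le_cmod[of z] by simp
      then have le: "2 * pi * \<bar>Im z\<bar> * \<bar>u\<bar> \<le> K * \<bar>u\<bar>"
        unfolding K_def by (intro mult_right_mono mult_left_mono) auto
      have "- (2 * pi * Im z * u) \<le> \<bar>2 * pi * Im z * u\<bar>"
        by (rule abs_ge_minus_self)
      also have "\<dots> = 2 * pi * \<bar>Im z\<bar> * \<bar>u\<bar>"
        by (simp add: abs_mult)
      finally have le: "- (2 * pi * Im z * u) \<le> K * \<bar>u\<bar>"
        using le by linarith
      have "norm (theta_term \<epsilon> z \<tau> n) \<le> exp (- (pi * Im \<tau>) * u\<^sup>2 + K * \<bar>u\<bar>)"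
        using le by (simp add: norm_theta_term u_def)
      also have "\<dots> \<le> exp (- (pi * Im \<tau>) * u\<^sup>2 + K * u) + exp (- (pi * Im \<tau>) * u\<^sup>2 + (- K) * u)"
        by (cases "u \<ge> 0") auto
      finally show ?thesis by (simp add: M_def u_def)
    qed
    ultimately have "uniform_limit (cball 0 r) (\<lambda>X z. \<Sum>n\<in>X. theta_term \<epsilon> z \<tau> n)
        (\<lambda>z. \<Sum>\<^sub>\<infinity>n. theta_term \<epsilon> z \<tau> n) (finite_subsets_at_top UNIV)"
      by (intro Weierstrass_m_test_general) auto
    moreover have "(\<lambda>z. \<Sum>n\<in>X. theta_term \<epsilon> z \<tau> n) holomorphic_on A" for X A
      unfolding theta_term_def by (intro holomorphic_intros)
    ultimately show ?thesis
      unfolding theta_eq_infsum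
      by (elim holomorphic_uniform_limit[rotated])
         (auto intro!: always_eventually holomorphic_on_imp_continuous_on)
  qed
  then have "(\<lambda>z. theta \<epsilon> z \<tau>) holomorphic_on (\<Union>r. ball 0 r)"
    by (intro holomorphic_on_UN_open) auto
  also have "(\<Union>r. ball (0::complex) r) = UNIV"
  proof -
    have "z \<in> ball 0 (norm z + 1)" for z :: complex
      by simp
    then show ?thesis by blast
  qed
  finally show ?thesis .
qed

lemma theta_has_derivative [derivative_intros]:
  assumes "Im \<tau> > 0" "(g has_field_derivative g') (at z)"
  shows "((\<lambda>z. theta \<epsilon> (g z) \<tau>) has_field_derivative
           deriv (\<lambda>z. theta \<epsilon> z \<tau>) (g z) * g') (at z)"
  by (rule DERIV_chain2[OF holomorphic_derivI[OF theta_holomorphic[OF assms(1)]] assms(2)]) auto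

lemma theta_deriv_eq:
  assumes "Im \<tau> > 0"
  shows "theta_deriv \<epsilon> \<epsilon>' \<tau> = deriv (\<lambda>z. theta \<epsilon> z \<tau>) (of_real \<epsilon>' / 2)"
  unfolding theta_deriv_def theta_char_shift[of \<epsilon> \<epsilon>']
  by (rule DERIV_imp_deriv) (use assms in \<open>auto intro!: derivative_eq_intros\<close>)

section \<open>Periodicity and parity\<close>

lemma theta_reindex:
  assumes "bij h" "\<And>n. theta_term \<epsilon> z \<tau> (h n) = c * theta_term \<delta> w \<tau> n"
  shows "theta \<epsilon> z \<tau> = c * theta \<delta> w \<tau>"
  unfolding theta_eq_infsum infsum_cmult_right'[symmetric] assms(2)[symmetric]
  by (rule infsum_reindex_bij_betw[OF assms(1), symmetric])

lemma theta_plus_int: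
  "theta \<epsilon> (z + of_int k) \<tau> = exp (of_real pi * \<i> * of_real \<epsilon> * of_int k) * theta \<epsilon> z \<tau>"
proof (rule theta_reindex[OF bij_id])
  fix n :: int
  have "theta_term \<epsilon> (z + of_int k) \<tau> n = exp (2 * of_real pi * \<i> * of_int (n * k)) *
          (exp (of_real pi * \<i> * of_real \<epsilon> * of_int k) * theta_term \<epsilon> z \<tau> n)"
    unfolding theta_term_def exp_add[symmetric]
    by (rule arg_cong[where f = exp]) (simp add: field_simps)
  moreover have "exp (2 * of_real pi * \<i> * of_int (n * k)) = (1 :: complex)"
    using exp_integer_2pi[of "of_int (n * k)"] by (simp add: mult_ac)
  ultimately show "theta_term \<epsilon> (z + of_int k) \<tau> (id n) =
      exp (of_real pi * \<i> * of_real \<epsilon> * of_int k) * theta_term \<epsilon> z \<tau> n"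
    by simp
qed

lemma theta_char_plus_2: "theta (\<epsilon> + 2) z \<tau> = theta \<epsilon> z \<tau>"
proof -
  have "theta_term (\<epsilon> + 2) z \<tau> (n - 1) = theta_term \<epsilon> z \<tau> n" for n
    by (simp add: theta_term_def add_divide_distrib)
  moreover have "bij (\<lambda>n::int. n - 1)"
    by (rule bij_betw_byWitness[where f' = "\<lambda>n. n + 1"]) auto
  ultimately show ?thesis
    using theta_reindex[of "\<lambda>n. n - 1" "\<epsilon> + 2" z \<tau> 1 \<epsilon> z] by simp
qed

lemma theta_minus: "theta (- \<epsilon>) (- z) \<tau> = theta \<epsilon> z \<tau>"
proof -
  have "theta_term (- \<epsilon>) (- z) \<tau> (- n) = theta_term \<epsilon> z \<tau> n" for n
    by (simp add: theta_term_def power2_eq_square algebra_simps)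
  then show ?thesis
    using theta_reindex[of uminus "- \<epsilon>" "- z" \<tau> 1 \<epsilon> z] by (simp add: bij_uminus)
qed

lemma theta0_plus_1: "theta 0 (z + 1) \<tau> = theta 0 z \<tau>"
  using theta_plus_int[of 0 z 1] by simp

lemma theta1_plus_1: "theta 1 (z + 1) \<tau> = - theta 1 z \<tau>"
  using theta_plus_int[of 1 z 1] by (simp add: exp_eq_polar)

lemma theta0_even: "theta 0 (- z) \<tau> = theta 0 z \<tau>"
  using theta_minus[of 0] by simp

lemma theta1_even: "theta 1 (- z) \<tau> = theta 1 z \<tau>"
  using theta_minus[of 1 z] theta_char_plus_2[of "- 1" "- z"] by simp

lemma theta1_half: "theta 1 (1 / 2) \<tau> = 0"
  using theta1_plus_1[of "- 1 / 2"] theta1_even[of "1 / 2"] by simp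

text \<open>
  An even function of period 1 is symmetric about every multiple of 1/2, hence stationary there.
\<close>

lemma theta0_deriv_half_int:
  assumes "Im \<tau> > 0" "2 * z \<in> \<int>"
  shows "deriv (\<lambda>z. theta 0 z \<tau>) z = 0"
proof -
  define s' where "s' = deriv (\<lambda>z. theta 0 z \<tau>) z"
  have symm: "theta 0 (z - h) \<tau> = theta 0 (z + h) \<tau>" for h
  proof -
    obtain k where k: "2 * z = of_int k"
      using assms(2) by (elim Ints_cases)
    have "theta 0 (w - 2 * z) \<tau> = theta 0 w \<tau>" for w
      using theta_plus_int[of 0 w "- k"] by (simp add: k)
    from this[of "z + h"] show ?thesis
      using theta0_even[of "z - h"] by (simp add: algebra_simps)
  qed
  have "((\<lambda>h. theta 0 (z + h) \<tau>) has_field_derivative s') (at 0)"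
    unfolding s'_def using assms by (auto intro!: derivative_eq_intros)
  moreover have "((\<lambda>h. theta 0 (z - h) \<tau>) has_field_derivative - s') (at 0)"
    unfolding s'_def using assms by (auto intro!: derivative_eq_intros)
  ultimately have "s' = - s'"
    unfolding symm by (rule DERIV_unique)
  then show ?thesis by (simp add: s'_def)
qed

section \<open>The product formula\<close>

lemma has_sum_product:
  fixes f :: "'a \<Rightarrow> complex" and g :: "'b \<Rightarrow> complex"
  assumes "(\<lambda>x. norm (f x)) summable_on A" "(\<lambda>y. norm (g y)) summable_on B"
    and f: "(f has_sum a) A" and g: "(g has_sum b) B"
  shows "((\<lambda>(x, y). f x * g y) has_sum a * b) (A \<times> B)"
proof (rule has_sum_SigmaI)
  show "((\<lambda>y. case (x, y) of (x, y) \<Rightarrow> f x * g y) has_sum f x * b) B" for x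
    using has_sum_cmult_right[OF g] by simp
  show "((\<lambda>x. f x * b) has_sum a * b) A"
    using has_sum_cmult_left[OF f] .
  have "(\<lambda>(x, y). norm (f x) * norm (g y)) summable_on A \<times> B"
  proof (rule summable_on_SigmaI)
    show "((\<lambda>y. case (x, y) of (x, y) \<Rightarrow> norm (f x) * norm (g y)) has_sum
             norm (f x) * (\<Sum>\<^sub>\<infinity>y\<in>B. norm (g y))) B" for x
      using has_sum_cmult_right[OF has_sum_infsum[OF assms(2)]] by simp
    show "(\<lambda>x. norm (f x) * (\<Sum>\<^sub>\<infinity>y\<in>B. norm (g y))) summable_on A"
      using assms(1) by (rule summable_on_cmult_left)
  qed auto
  then show "(\<lambda>(x, y). f x * g y) summable_on A \<times> B"
    using abs_summable_summable[of "\<lambda>(x, y). f x * g y" "A \<times> B"]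
    by (simp add: case_prod_unfold norm_mult)
qed

text \<open>
  With \<open>u = m + \<epsilon>/2\<close> and \<open>v = n + \<epsilon>/2\<close>, put \<open>P = (u+v)/2\<close> and \<open>R = (u-v)/2\<close>.  Then
  \<open>u\<^sup>2 + v\<^sup>2 = 2(P\<^sup>2 + R\<^sup>2)\<close> and \<open>u(x+y) + v(x-y) = 2xP + 2yR\<close>, so the double series separates again,
  with \<open>\<tau>\<close> doubled.  The pairs with \<open>m + n\<close> even give \<open>(P,R) \<in> (\<int> + \<epsilon>/2) \<times> \<int>\<close>; the
  odd ones give the same set shifted by \<open>(1/2, 1/2)\<close>.
\<close>

lemma theta_product:
  assumes "Im \<tau> > 0"
  shows "theta \<epsilon> (x + y) \<tau> * theta \<epsilon> (x - y) \<tau> =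
           theta \<epsilon> (2 * x) (2 * \<tau>) * theta 0 (2 * y) (2 * \<tau>)
           + theta (\<epsilon> + 1) (2 * x) (2 * \<tau>) * theta 1 (2 * y) (2 * \<tau>)"
proof -
  define F where "F = (\<lambda>(m, n). theta_term \<epsilon> (x + y) \<tau> m * theta_term \<epsilon> (x - y) \<tau> n)"
  define even_pair where "even_pair = (\<lambda>(p::int, r::int). (p + r, p - r))"
  define odd_pair where "odd_pair = (\<lambda>(p::int, r::int). (p + r + 1, p - r))"
  have pos: "Im (2 * \<tau>) > 0" using assms by simp
  have even_term: "F \<circ> even_pair =
      (\<lambda>(p, r). theta_term \<epsilon> (2 * x) (2 * \<tau>) p * theta_term 0 (2 * y) (2 * \<tau>) r)"
  proof -
    have "F (even_pair (p, r)) = theta_term \<epsilon> (2 * x) (2 * \<tau>) p * theta_term 0 (2 * y) (2 * \<tau>) r" for p r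
      unfolding F_def even_pair_def theta_term_def prod.case exp_add[symmetric]
      by (rule arg_cong[where f = exp]) (simp add: field_simps power2_eq_square)
    then show ?thesis by auto
  qed
  have odd_term: "F \<circ> odd_pair =
      (\<lambda>(p, r). theta_term (\<epsilon> + 1) (2 * x) (2 * \<tau>) p * theta_term 1 (2 * y) (2 * \<tau>) r)"
  proof -
    have "F (odd_pair (p, r)) = theta_term (\<epsilon> + 1) (2 * x) (2 * \<tau>) p * theta_term 1 (2 * y) (2 * \<tau>) r" for p r
      unfolding F_def odd_pair_def theta_term_def prod.case exp_add[symmetric]
      by (rule arg_cong[where f = exp]) (simp add: field_simps power2_eq_square)
    then show ?thesis by auto
  qed
  have "inj even_pair" "inj odd_pair"
    by (auto simp: inj_def even_pair_def odd_pair_def)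
  have even_sum: "(F has_sum theta \<epsilon> (2 * x) (2 * \<tau>) * theta 0 (2 * y) (2 * \<tau>)) (range even_pair)"
    unfolding has_sum_reindex[OF \<open>inj even_pair\<close>] even_term
    using has_sum_product[OF theta_term_abs_summable[OF pos] theta_term_abs_summable[OF pos]
        theta_has_sum[OF pos, of \<epsilon> "2 * x"] theta_has_sum[OF pos, of 0 "2 * y"]] by simp
  have odd_sum: "(F has_sum theta (\<epsilon> + 1) (2 * x) (2 * \<tau>) * theta 1 (2 * y) (2 * \<tau>)) (range odd_pair)"
    unfolding has_sum_reindex[OF \<open>inj odd_pair\<close>] odd_term
    using has_sum_product[OF theta_term_abs_summable[OF pos] theta_term_abs_summable[OF pos]
        theta_has_sum[OF pos, of "\<epsilon> + 1" "2 * x"] theta_has_sum[OF pos, of 1 "2 * y"]] by simp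
  have disjoint: "range even_pair \<inter> range odd_pair = {}"
    by (auto simp: even_pair_def odd_pair_def) presburger
  have cover: "range even_pair \<union> range odd_pair = UNIV"
  proof (intro equalityI subsetI UNIV_I)
    fix mn :: "int \<times> int"
    obtain m n where mn: "mn = (m, n)" by force
    show "mn \<in> range even_pair \<union> range odd_pair"
    proof (cases "even (m + n)")
      case True
      then have "mn = even_pair ((m + n) div 2, (m - n) div 2)"
        unfolding mn even_pair_def by simp presburger
      then show ?thesis by blast
    next
      case False
      then have "mn = odd_pair ((m + n - 1) div 2, (m - n - 1) div 2)"
        unfolding mn odd_pair_def by simp presburger
      then show ?thesis by blast
    qed
  qed
  have "(F has_sum theta \<epsilon> (2 * x) (2 * \<tau>) * theta 0 (2 * y) (2 * \<tau>)
      + theta (\<epsilon> + 1) (2 * x) (2 * \<tau>) * theta 1 (2 * y) (2 * \<tau>)) UNIV"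
    using has_sum_Un_disjoint[OF even_sum odd_sum disjoint] by (simp only: cover)
  moreover have "(F has_sum theta \<epsilon> (x + y) \<tau> * theta \<epsilon> (x - y) \<tau>) UNIV"
    using has_sum_product[OF theta_term_abs_summable[OF assms] theta_term_abs_summable[OF assms]
        theta_has_sum[OF assms, of \<epsilon> "x + y"] theta_has_sum[OF assms, of \<epsilon> "x - y"]]
    unfolding F_def by simp
  ultimately show ?thesis by (rule has_sum_unique[symmetric])
qed

section \<open>Nonvanishing on the real line\<close>

text \<open>
  For real \<open>x\<close> the term of index \<open>n\<close> has modulus \<open>exp (- \<pi> t n\<^sup>2)\<close> with \<open>t\<close> the imaginary part
  of \<open>\<tau>\<close>.  When \<open>t \<ge> 1\<close> and \<open>n \<noteq> 0\<close>, the inequality \<open>t n\<^sup>2 \<ge> (t - 1) + n\<^sup>2\<close> pulls a factor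
  \<open>exp (- \<pi> (t - 1))\<close> out of a convergent series that does not depend on \<open>t\<close>, so the constant
  term 1 dominates as soon as \<open>t\<close> is large.
\<close>

lemma theta0_nonzero_high:
  "\<exists>T. \<forall>\<tau> x. Im \<tau> \<ge> T \<longrightarrow> x \<in> \<real> \<longrightarrow> theta 0 x \<tau> \<noteq> 0"
proof -
  define S where "S = (\<Sum>\<^sub>\<infinity>n\<in>-{0::int}. exp (- pi * (of_int n)\<^sup>2))"
  have summ: "(\<lambda>n. exp (- pi * (of_int n)\<^sup>2)) summable_on -{0::int}"
    using summable_on_gaussian[of pi 0 0] summable_on_subset by force
  have "((\<lambda>t. exp (- pi * (t - 1)) * S) \<longlongrightarrow> 0) at_top"
    by real_asymp
  then have "eventually (\<lambda>t. exp (- pi * (t - 1)) * S < 1 \<and> t \<ge> 1) at_top"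
    by (intro eventually_conj order_tendstoD(2) eventually_ge_at_top) auto
  then obtain T where T: "\<And>t. t \<ge> T \<Longrightarrow> exp (- pi * (t - 1)) * S < 1 \<and> t \<ge> 1"
    unfolding eventually_at_top_linorder by blast
  have "theta 0 x \<tau> \<noteq> 0" if "Im \<tau> \<ge> T" "x \<in> \<real>" for \<tau> x
  proof -
    define t where "t = Im \<tau>"
    have t: "exp (- pi * (t - 1)) * S < 1" "t \<ge> 1" "Im \<tau> > 0"
      using T[OF that(1)] by (auto simp: t_def)
    have "(theta_term 0 x \<tau> has_sum (theta 0 x \<tau> - theta_term 0 x \<tau> 0)) (UNIV - {0})"
      using has_sum_Diff[OF theta_has_sum[OF t(3)] has_sum_finite[of "{0}"]] by auto
    moreover have "theta_term 0 x \<tau> 0 = 1"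
      by (simp add: theta_term_def)
    ultimately have eq: "theta 0 x \<tau> - 1 = (\<Sum>\<^sub>\<infinity>n\<in>-{0}. theta_term 0 x \<tau> n)"
      by (simp add: infsumI Compl_eq_Diff_UNIV)
    have bound: "norm (theta_term 0 x \<tau> n) \<le> exp (- pi * (t - 1)) * exp (- pi * (of_int n)\<^sup>2)"
      if "n \<in> -{0}" for n
    proof -
      have "(1::real) \<le> (of_int n)\<^sup>2"
        using that by (metis ComplD int_one_le_iff_zero_less of_int_1_le_iff of_int_power singletonI zero_less_power2)
      then have "(t - 1) * 1 \<le> (t - 1) * (of_int n)\<^sup>2"
        using t by (intro mult_left_mono) auto
      then have "pi * ((t - 1) + (of_int n)\<^sup>2) \<le> pi * (t * (of_int n)\<^sup>2)"
        by (intro mult_left_mono) (auto simp: algebra_simps)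
      moreover have "Im x = 0" using \<open>x \<in> \<real>\<close> by (simp add: complex_is_Real_iff)
      ultimately show ?thesis
        by (simp add: norm_theta_term t_def exp_add[symmetric] algebra_simps)
    qed
    have summ': "(\<lambda>n. norm (theta_term 0 x \<tau> n)) summable_on -{0}"
      by (rule summable_on_subset[OF theta_term_abs_summable[OF t(3)]]) auto
    have "norm (theta 0 x \<tau> - 1) \<le> (\<Sum>\<^sub>\<infinity>n\<in>-{0}. norm (theta_term 0 x \<tau> n))"
      unfolding eq by (rule norm_infsum_bound[OF summ'])
    also have "\<dots> \<le> (\<Sum>\<^sub>\<infinity>n\<in>-{0::int}. exp (- pi * (t - 1)) * exp (- pi * (of_int n)\<^sup>2))"
      by (rule infsum_mono[OF summ' summable_on_cmult_right[OF summ] bound])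
    also have "\<dots> < 1"
      using t(1) by (simp add: S_def infsum_cmult_right')
    finally show ?thesis by auto
  qed
  then show ?thesis by blast
qed

text \<open>
  The descent \<open>\<tau> \<mapsto> 2\<tau>\<close>: in the product formula at \<open>z + 1/4 \<plusminus> 1/4\<close> the second summand drops out
  because \<open>\<theta>[1,0](1/2) = 0\<close>, so \<open>s(z,\<tau>)\<close> is a factor of a product of two values of \<open>s\<close> at
  \<open>2\<tau>\<close>, with arguments that are still real.
\<close>

lemma theta_real_nonzero:
  assumes "Im \<tau> > 0" "x \<in> \<real>"
  shows "theta 0 x \<tau> \<noteq> 0"
proof -
  obtain T where T: "\<And>\<tau> x. Im \<tau> \<ge> T \<Longrightarrow> x \<in> \<real> \<Longrightarrow> theta 0 x \<tau> \<noteq> 0"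
    using theta0_nonzero_high by blast
  have descent: "theta 0 x \<tau> \<noteq> 0" if "2 ^ k * Im \<tau> \<ge> T" "Im \<tau> > 0" "x \<in> \<real>" for k \<tau> x
    using that
  proof (induction k arbitrary: \<tau> x)
    case 0
    then show ?case using T by simp
  next
    case (Suc k)
    have "theta 0 (x + 1 / 2) \<tau> * theta 0 x \<tau> =
            theta 0 (2 * x + 1 / 2) (2 * \<tau>) * theta 0 (1 / 2) (2 * \<tau>)"
      using theta_product[of \<tau> 0 "x + 1 / 4" "1 / 4"] Suc.prems
      by (simp add: theta1_half add.assoc)
    moreover have "theta 0 w (2 * \<tau>) \<noteq> 0" if "w \<in> \<real>" for w
      by (rule Suc.IH) (use Suc.prems that in \<open>auto simp: mult_ac\<close>)
    moreover have "2 * x + 1 / 2 \<in> \<real>" "1 / 2 \<in> (\<real> :: complex set)"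
      using Suc.prems by (auto intro!: Reals_add Reals_mult Reals_divide)
    ultimately show ?case by auto
  qed
  obtain k where "T / Im \<tau> < 2 ^ k"
    using real_arch_pow[of 2 "T / Im \<tau>"] by auto
  then have "2 ^ k * Im \<tau> \<ge> T"
    using assms by (simp add: field_simps)
  then show ?thesis using assms by (rule descent)
qed

section \<open>The addition formula and its derivative\<close>

text \<open>
  Shifting the first argument by 1/2 in the product formula for \<open>\<theta>[1,0]\<close> changes one sign, which
  turns the symmetric form on the right into a determinant.
\<close>

lemma theta11_product:
  assumes "Im \<tau> > 0"
  shows "theta 1 (x + y + 1 / 2) \<tau> * theta 1 (x - y + 1 / 2) \<tau> =
           theta 0 (2 * x) (2 * \<tau>) * theta 1 (2 * y) (2 * \<tau>)
           - theta 1 (2 * x) (2 * \<tau>) * theta 0 (2 * y) (2 * \<tau>)"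
  using theta_product[of \<tau> 1 "x + 1 / 2" y] assms theta_char_plus_2[of 0 "2 * x + 1" "2 * \<tau>"]
    theta0_plus_1[of "2 * x" "2 * \<tau>"] theta1_plus_1[of "2 * x" "2 * \<tau>"]
  by (simp add: algebra_simps)

text \<open>
  Both product formulas use the same vector \<open>v\<close>, so
  \<open>(a \<bullet> b)(c \<bullet> d) - (a \<bullet> d)(c \<bullet> b) = det(a,c) det(b,d)\<close>, applied to
  \<open>v(2a)\<close>, \<open>v(2b)\<close>, \<open>v(2c)\<close>, \<open>v(2d)\<close>, becomes a relation between theta values at the original \<open>\<tau>\<close>.
\<close>

lemma theta_addition:
  fixes \<tau> :: complex
  assumes "Im \<tau> > 0"
  defines "s \<equiv> \<lambda>z. theta 0 z \<tau>" and "o1 \<equiv> \<lambda>z. theta 1 (z + 1 / 2) \<tau>"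
  shows "s (a + b) * s (a - b) * (s (c + d) * s (c - d))
         - s (a + d) * s (a - d) * (s (c + b) * s (c - b))
         = o1 (a + c) * o1 (a - c) * (o1 (b + d) * o1 (b - d))"
proof -
  have s: "s (x + y) * s (x - y) = theta 0 (2 * x) (2 * \<tau>) * theta 0 (2 * y) (2 * \<tau>)
             + theta 1 (2 * x) (2 * \<tau>) * theta 1 (2 * y) (2 * \<tau>)" for x y
    using theta_product[of \<tau> 0 x y] assms by (simp add: s_def)
  show ?thesis
    unfolding s theta11_product[OF assms(1)] o1_def by algebra
qed

text \<open>
  The addition formula is used at \<open>a = 0\<close>, \<open>b = x + h\<close>, \<open>c = 2x\<close>, \<open>d = x\<close>.  Its right-hand side
  contains the factor \<open>o(h)\<close>, which vanishes at \<open>h = 0\<close>, so that its derivative there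
  involves only \<open>o'(0)\<close>; on the left, the logarithmic derivatives of \<open>s\<close> at \<open>\<plusminus>x\<close> and \<open>3x\<close> add up.
\<close>

lemma theta_triple_derivative:
  fixes \<tau> x :: complex
  assumes "Im \<tau> > 0"
  defines "s \<equiv> \<lambda>z. theta 0 z \<tau>" and "o1 \<equiv> \<lambda>z. theta 1 (z + 1 / 2) \<tau>"
  shows "s x ^ 2 * (3 * deriv s x * s (3 * x) - deriv s (3 * x) * s x)
           = - (o1 (2 * x) ^ 3 * deriv (\<lambda>z. theta 1 z \<tau>) (1 / 2))"
proof -
  have odd: "o1 (- z) = - o1 z" for z
  proof -
    have "- z + 1 / 2 = - (z + 1 / 2) + 1"
      by simp
    then show ?thesis
      unfolding o1_def by (simp only: theta1_plus_1 theta1_even)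
  qed
  have eq: "s (x + h) ^ 2 * s (3 * x) * s x - s x ^ 2 * s (3 * x + h) * s (x - h)
              = - (o1 (2 * x) ^ 2 * o1 (2 * x + h) * o1 h)" for h
  proof -
    have "s (0 + (x + h)) * s (0 - (x + h)) * (s (2 * x + x) * s (2 * x - x))
         - s (0 + x) * s (0 - x) * (s (2 * x + (x + h)) * s (2 * x - (x + h)))
         = o1 (0 + 2 * x) * o1 (0 - 2 * x) * (o1 (x + h + x) * o1 (x + h - x))"
      unfolding s_def o1_def by (rule theta_addition[OF assms(1)])
    moreover have "s (- (x + h)) = s (x + h)" "s (- x) = s x"
      unfolding s_def by (rule theta0_even)+
    ultimately show ?thesis
      using odd[of "2 * x"] by (simp add: power2_eq_square algebra_simps)
  qed
  have s_deriv: "((\<lambda>h. s (g h)) has_field_derivative deriv s (g 0) * g') (at 0)"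
    if "(g has_field_derivative g') (at 0)" for g g'
    unfolding s_def by (rule theta_has_derivative[OF assms(1) that])
  have o1_deriv: "((\<lambda>h. o1 (g h)) has_field_derivative deriv (\<lambda>z. theta 1 z \<tau>) (g 0 + 1 / 2) * g') (at 0)"
    if "(g has_field_derivative g') (at 0)" for g g'
    unfolding o1_def by (rule theta_has_derivative[OF assms(1)]) (use that in \<open>auto intro!: derivative_eq_intros\<close>)
  have "o1 0 = 0"
    by (simp add: o1_def theta1_half)
  have "((\<lambda>h. s (x + h) ^ 2 * s (3 * x) * s x - s x ^ 2 * s (3 * x + h) * s (x - h))
      has_field_derivative s x ^ 2 * (3 * deriv s x * s (3 * x) - deriv s (3 * x) * s x)) (at 0)"
    by (auto intro!: derivative_eq_intros s_deriv simp: power2_eq_square algebra_simps)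
  moreover have "((\<lambda>h. - (o1 (2 * x) ^ 2 * o1 (2 * x + h) * o1 h)) has_field_derivative
      - (o1 (2 * x) ^ 3 * deriv (\<lambda>z. theta 1 z \<tau>) (1 / 2))) (at 0)"
    by (auto intro!: derivative_eq_intros o1_deriv simp: \<open>o1 0 = 0\<close> power2_eq_square power3_eq_cube algebra_simps)
  ultimately show ?thesis
    unfolding eq by (rule DERIV_unique)
qed

section \<open>The derivative formulas\<close>

text \<open>
  The two points \<open>x = 1/6\<close> and \<open>x = 1/3\<close> share the value \<open>o(2x) = -\<theta>[1,0](1/6)\<close>, by
  \<open>2x + 1/2 = 1 \<mp> 1/6\<close> and because \<open>\<theta>[1,0]\<close> is even and changes sign under \<open>z \<mapsto> z + 1\<close>.
\<close>

lemma theta0_derivative_formula: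
  assumes "Im \<tau> > 0" "x \<in> {1 / 6, 1 / 3}"
  shows "deriv (\<lambda>z. theta 0 z \<tau>) x =
           1 / 3 * (deriv (\<lambda>z. theta 1 z \<tau>) (1 / 2) * theta 1 (1 / 6) \<tau> ^ 3
             / (theta 0 x \<tau> ^ 2 * theta 0 (3 * x) \<tau>))"
proof -
  have "theta 1 (2 * x + 1 / 2) \<tau> = - theta 1 (1 / 6) \<tau>"
  proof -
    have "2 * x + 1 / 2 = - (1 / 6) + 1 \<or> 2 * x + 1 / 2 = 1 / 6 + 1"
      using assms(2) by (elim insertE emptyE; hypsubst; simp)
    then show ?thesis
      by (elim disjE) (simp_all only: theta1_plus_1 theta1_even)
  qed
  moreover have "deriv (\<lambda>z. theta 0 z \<tau>) (3 * x) = 0"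
  proof (rule theta0_deriv_half_int[OF assms(1)])
    show "2 * (3 * x) \<in> \<int>"
      using assms(2) by (elim insertE emptyE; hypsubst; simp)
  qed
  ultimately have "theta 0 x \<tau> ^ 2 * (3 * deriv (\<lambda>z. theta 0 z \<tau>) x * theta 0 (3 * x) \<tau>)
      = theta 1 (1 / 6) \<tau> ^ 3 * deriv (\<lambda>z. theta 1 z \<tau>) (1 / 2)"
    using theta_triple_derivative[OF assms(1), of x] by simp
  moreover have "theta 0 x \<tau> \<noteq> 0" "theta 0 (3 * x) \<tau> \<noteq> 0"
  proof -
    have "x \<in> \<real>"
      using assms(2) by (elim insertE emptyE; hypsubst; auto intro: Reals_divide)
    then show "theta 0 x \<tau> \<noteq> 0" "theta 0 (3 * x) \<tau> \<noteq> 0"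
      by (intro theta_real_nonzero[OF assms(1)] Reals_mult Reals_numeral; assumption)+
  qed
  ultimately show ?thesis
    by (simp add: field_simps)
qed

theorem theorem5p1:
  fixes \<tau> :: complex
  assumes "\<tau> \<in> upper_half_plane"
  shows "theta_deriv 0 (1/3) \<tau> =
           1/3 * (theta_deriv 1 1 \<tau> * theta_const 1 (1/3) \<tau> ^ 3
                  / (theta_const 0 (1/3) \<tau> ^ 2 * theta_const 0 1 \<tau>))
         \<and> theta_deriv 0 (2/3) \<tau> =
           1/3 * (theta_deriv 1 1 \<tau> * theta_const 1 (1/3) \<tau> ^ 3
                  / (theta_const 0 (2/3) \<tau> ^ 2 * theta_const 0 0 \<tau>))"
proof -
  have pos: "Im \<tau> > 0"
    using assms by (simp add: upper_half_plane_def)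
  have const: "theta_const \<epsilon> \<epsilon>' \<tau> = theta \<epsilon> (of_real \<epsilon>' / 2) \<tau>" for \<epsilon> \<epsilon>'
    using theta_char_shift[of \<epsilon> \<epsilon>' 0] by (simp add: theta_const_def)
  show ?thesis
    using theta0_derivative_formula[OF pos, of "1 / 6"] theta0_derivative_formula[OF pos, of "1 / 3"]
      theta0_plus_1[of 0 \<tau>]
    by (simp add: const theta_deriv_eq[OF pos])
qed

end
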